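(* Let $G=(V,E)$ be a strongly regular graph with vertex degree $d$ (and parameter $\beta\ge1$). (i) If $G$ has girth $4$, then for any $x\in V$, $$\mathcal K_{G,x}(\mathcal N)=2-\frac{2d}{\mathcal N}\qquad\text{for all }\mathcal N\in(0,\infty].$$ (ii) If $G$ has girth $5$, then for any $x\in V$, $$\mathcal K_{G,x}(\mathcal N)=\begin{cases}2-\frac{2d}{\mathcal N},&\text{if }0<\mathcal N\le2,\\[1mm]2-d,&\text{if }\mathcal N>2.\end{cases}$$
   Context: For a locally finite simple graph $G=(V,E)$ and $f:V\to\mathbb R$ put $\Delta f(x)=\sum_{y\sim x}(f(y)-f(x))$ (non-normalized Laplacian), and for $f,g:V\to\mathbb R$ put $2\Gamma(f,g)=\Delta(fg)-f\Delta g-g\Delta f$, $2\Gamma_2(f,g)=\Delta\Gamma(f,g)-\Gamma(f,\Delta g)-\Gamma(\Delta f,g)$, $\Gamma(f)=\Gamma(f,f)$, $\Gamma_2(f)=\Gamma_2(f,f)$. For $\mathcal N\in(0,\infty]$ (convention $1/\infty=0$), $\mathcal K_{G,x}(\mathcal N)$ is the largest $K\in\mathbb R$ such that $\Gamma_2(f)(x)\ge\frac1{\mathcal N}(\Delta f(x))^2+K\,\Gamma(f)(x)$ for all $f:V\to\mathbb R$ (Bakry-Émery curvature function). A finite simple $d$-regular graph with $N$ vertices is strongly regular with parameters $(N,d,\alpha,\beta)$ if every two adjacent vertices have exactly $\alpha$ common neighbours and every two distinct non-adjacent vertices have exactly $\beta$ common neighbours. Complete graphs and disjoint unions of copies of a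 complete graph are regarded as the case $\beta=0$ and are excluded. The girth is the length of a shortest cycle. *)

theory Defs
  imports "HOL-Analysis.Analysis" "Graph_Theory.Graph_Theory"
begin

text \<open>
  A finite simple graph is a \<^locale>\<open>pair_graph\<close>: a finite, symmetric, loop-free digraph whose arcs
  are pairs of vertices, so each undirected edge is represented by two opposite arcs. Functions on
  the vertex set are functions on the whole vertex type; at a vertex, the operators below depend
  only on their values at vertices of the graph.
\<close>

definition nbrs :: "'a pair_pre_digraph \<Rightarrow> 'a \<Rightarrow> 'a set" where
  "nbrs G x = {y. x \<rightarrow>\<^bsub>with_proj G\<^esub> y}"

definition laplacian :: "'a pair_pre_digraph \<Rightarrow> ('a \<Rightarrow> real) \<Rightarrow> 'a \<Rightarrow> real" where
  "laplacian G f x = (\<Sum>y\<in>nbrs G x. f y - f x)"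

definition Gam :: "'a pair_pre_digraph \<Rightarrow> ('a \<Rightarrow> real) \<Rightarrow> ('a \<Rightarrow> real) \<Rightarrow> 'a \<Rightarrow> real" where
  "Gam G f g x =
     (laplacian G (\<lambda>y. f y * g y) x - f x * laplacian G g x - g x * laplacian G f x) / 2"

definition Gam2 :: "'a pair_pre_digraph \<Rightarrow> ('a \<Rightarrow> real) \<Rightarrow> ('a \<Rightarrow> real) \<Rightarrow> 'a \<Rightarrow> real" where
  "Gam2 G f g x =
     (laplacian G (Gam G f g) x - Gam G f (laplacian G g) x - Gam G (laplacian G f) g x) / 2"

text \<open>
  The dimension \<open>N\<close> ranges over the extended reals in \<open>(0,\<infinity>]\<close>; division in \<^typ>\<open>ereal\<close> gives
  \<open>1 / \<infinity> = 0\<close>.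
\<close>

definition curvature_dim :: "'a pair_pre_digraph \<Rightarrow> 'a \<Rightarrow> ereal \<Rightarrow> real \<Rightarrow> bool" where
  "curvature_dim G x N K \<longleftrightarrow>
     (\<forall>f. Gam2 G f f x \<ge> real_of_ereal (1 / N) * (laplacian G f x)\<^sup>2 + K * Gam G f f x)"

text \<open>
  The largest \<open>K\<close> exists whenever \<open>x\<close> is not isolated, see \<open>BE_curvature_is_greatest\<close> below.
\<close>

definition BE_curvature :: "'a pair_pre_digraph \<Rightarrow> 'a \<Rightarrow> ereal \<Rightarrow> real" where
  "BE_curvature G x N = (GREATEST K. curvature_dim G x N K)"

text \<open>
  The second condition on \<open>\<beta>\<close> is the convention that complete graphs, for which the first one is
  void, have \<open>\<beta> = 0\<close>. For disjoint unions of at least two copies of a complete graph, \<open>\<beta> = 0\<close>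
  already follows from the first one. Hence \<open>\<beta> \<ge> 1\<close> excludes both.
\<close>

definition strongly_regular :: "'a pair_pre_digraph \<Rightarrow> nat \<Rightarrow> nat \<Rightarrow> nat \<Rightarrow> nat \<Rightarrow> bool" where
  "strongly_regular G n d \<alpha> \<beta> \<longleftrightarrow>
     pair_graph G \<and> card (pverts G) = n \<and>
     (\<forall>x\<in>pverts G. card (nbrs G x) = d) \<and>
     (\<forall>x\<in>pverts G. \<forall>y\<in>pverts G. x \<rightarrow>\<^bsub>with_proj G\<^esub> y \<longrightarrow>
        card (nbrs G x \<inter> nbrs G y) = \<alpha>) \<and>
     (\<forall>x\<in>pverts G. \<forall>y\<in>pverts G. x \<noteq> y \<and> \<not> x \<rightarrow>\<^bsub>with_proj G\<^esub> y \<longrightarrow>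
        card (nbrs G x \<inter> nbrs G y) = \<beta>) \<and>
     (complete_digraph n (with_proj G) \<longrightarrow> \<beta> = 0)"

text \<open>
  The closed walk of length 2 along an edge and back is a \<^const>\<open>pre_digraph.cycle\<close> but not a
  cycle of the undirected graph, hence the length bound. Acyclic graphs have girth \<open>\<infinity>\<close>.
\<close>

definition girth :: "'a pair_pre_digraph \<Rightarrow> enat" where
  "girth G = (INF p\<in>{p. pre_digraph.cycle (with_proj G) p \<and> length p \<ge> 3}. enat (length p))"

lemma Gam_eq:
  "Gam G f g x = (\<Sum>y\<in>nbrs G x. (f y - f x) * (g y - g x)) / 2"
proof -
  have "laplacian G (\<lambda>y. f y * g y) x - f x * laplacian G g x - g x * laplacian G f x
      = (\<Sum>y\<in>nbrs G x. (f y * g y - f x * g x) - f x * (g y - g x) - g x * (f y - f x))"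
    by (simp only: laplacian_def sum_distrib_left) (simp only: sum_subtractf)
  also have "\<dots> = (\<Sum>y\<in>nbrs G x. (f y - f x) * (g y - g x))"
    by (rule sum.cong) (simp_all add: algebra_simps)
  finally show ?thesis by (simp add: Gam_def)
qed

lemma Gam_nonneg: "Gam G f f x \<ge> 0"
  by (simp add: Gam_eq sum_nonneg)

lemma Gam2_eq:
  "2 * Gam2 G f f x = (\<Sum>y\<in>nbrs G x. \<Sum>z\<in>nbrs G y. (f z - f y)\<^sup>2 / 2 - (f y - f x) * (f z - f y))
     - real (card (nbrs G x)) * Gam G f f x + (laplacian G f x)\<^sup>2"
proof -
  have "2 * Gam2 G f f x = (\<Sum>y\<in>nbrs G x. Gam G f f y - Gam G f f x)
      - (\<Sum>y\<in>nbrs G x. (f y - f x) * (laplacian G f y - laplacian G f x))"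
    unfolding Gam2_def laplacian_def[of G "Gam G f f"] Gam_eq[of G f "laplacian G f"]
      Gam_eq[of G "laplacian G f" f]
    by (simp add: mult.commute)
  also have "\<dots> = (\<Sum>y\<in>nbrs G x. Gam G f f y - (f y - f x) * laplacian G f y)
      - real (card (nbrs G x)) * Gam G f f x + (\<Sum>y\<in>nbrs G x. f y - f x) * laplacian G f x"
    by (simp add: sum_subtractf right_diff_distrib flip: sum_distrib_right)
  also have "(\<Sum>y\<in>nbrs G x. f y - f x) * laplacian G f x = (laplacian G f x)\<^sup>2"
    by (simp add: laplacian_def power2_eq_square)
  also have "(\<lambda>y. Gam G f f y - (f y - f x) * laplacian G f y)
      = (\<lambda>y. (\<Sum>z\<in>nbrs G y. (f z - f y)\<^sup>2 / 2 - (f y - f x) * (f z - f y)))"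
    by (simp only: Gam_eq laplacian_def sum_distrib_left sum_divide_distrib power2_eq_square)
      (simp only: sum_subtractf)
  finally show ?thesis .
qed

lemma curvature_dim_exists:
  assumes "pair_graph G" "0 < N"
  shows "\<exists>K. curvature_dim G x N K"
proof -
  interpret pair_graph G by fact
  define c d M where "c = real_of_ereal (1 / N)" and "d = real (card (nbrs G x))"
    and "M = real (card (pverts G))"
  have c: "c \<ge> 0"
    using assms(2) by (cases N) (auto simp: c_def one_ereal_def)
  have sub: "nbrs G y \<subseteq> pverts G" for y
    by (auto simp: nbrs_def in_arcsD2)
  have M: "real (card (nbrs G y)) \<le> M" for y
    unfolding M_def using card_mono[OF pair_finite_verts sub] by simp
  have "Gam2 G f f x \<ge> c * (laplacian G f x)\<^sup>2 + (- (M + d) / 2 - 2 * d * c) * Gam G f f x" for f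
  proof -
    have S: "(\<Sum>y\<in>nbrs G x. (f y - f x)\<^sup>2) = 2 * Gam G f f x"
      by (simp add: Gam_eq power2_eq_square)
    have "- (M * Gam G f f x) = (\<Sum>y\<in>nbrs G x. - (M * ((f y - f x)\<^sup>2 / 2)))"
      using S by (simp add: sum_negf flip: sum_distrib_left sum_divide_distrib)
    also have "\<dots> \<le> (\<Sum>y\<in>nbrs G x. \<Sum>z\<in>nbrs G y. (f z - f y)\<^sup>2 / 2 - (f y - f x) * (f z - f y))"
    proof (rule sum_mono)
      fix y
      have "- (M * ((f y - f x)\<^sup>2 / 2)) \<le> (\<Sum>z\<in>nbrs G y. - ((f y - f x)\<^sup>2 / 2))"
        using mult_right_mono[OF M[of y], of "(f y - f x)\<^sup>2 / 2"] by simp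
      also have "\<dots> \<le> (\<Sum>z\<in>nbrs G y. (f z - f y)\<^sup>2 / 2 - (f y - f x) * (f z - f y))"
      proof (rule sum_mono)
        fix z
        show "- ((f y - f x)\<^sup>2 / 2) \<le> (f z - f y)\<^sup>2 / 2 - (f y - f x) * (f z - f y)"
          using zero_le_power2[of "(f z - f y) - (f y - f x)"]
          unfolding power2_diff[of "f z - f y" "f y - f x"]
          by (simp only: mult.commute[of "f y - f x"] mult.assoc)
      qed
      finally show "- (M * ((f y - f x)\<^sup>2 / 2))
        \<le> (\<Sum>z\<in>nbrs G y. (f z - f y)\<^sup>2 / 2 - (f y - f x) * (f z - f y))" .
    qed
    finally have 1: "2 * Gam2 G f f x \<ge> - ((M + d) * Gam G f f x)"
      using Gam2_eq[of G f x] zero_le_power2[of "laplacian G f x"]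
      unfolding d_def distrib_right by linarith
    have "(laplacian G f x)\<^sup>2 \<le> d * (\<Sum>y\<in>nbrs G x. (f y - f x)\<^sup>2)"
      using Cauchy_Schwarz_ineq_sum[of "\<lambda>_. 1" "\<lambda>y. f y - f x" "nbrs G x"]
      by (simp add: laplacian_def d_def)
    from mult_left_mono[OF this c]
    have "c * (laplacian G f x)\<^sup>2 \<le> 2 * d * c * Gam G f f x"
      unfolding S by (simp add: mult_ac)
    moreover have "(- (M + d) / 2 - 2 * d * c) * Gam G f f x
        = - ((M + d) * Gam G f f x) / 2 - 2 * d * c * Gam G f f x"
      by (simp only: left_diff_distrib)
    ultimately show ?thesis using 1 by linarith
  qed
  thus ?thesis unfolding curvature_dim_def c_def by blast
qed

lemma BE_curvature_is_greatest:
  assumes "pair_graph G" "0 < N" "nbrs G x \<noteq> {}"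
  shows "curvature_dim G x N (BE_curvature G x N)"
    and "curvature_dim G x N K \<Longrightarrow> K \<le> BE_curvature G x N"
proof -
  interpret pair_graph G by fact
  define S where "S = {K. curvature_dim G x N K}"
  define q where "q f = Gam2 G f f x - real_of_ereal (1 / N) * (laplacian G f x)\<^sup>2" for f
  have S: "K \<in> S \<longleftrightarrow> (\<forall>f. K * Gam G f f x \<le> q f)" for K
    by (auto simp: S_def q_def curvature_dim_def algebra_simps)
  obtain K0 where K0: "K0 \<in> S"
    using curvature_dim_exists[OF assms(1,2)] by (auto simp: S_def)
  obtain y where y: "y \<in> nbrs G x" using assms(3) by blast
  hence "y \<noteq> x" using pair_no_loops[of "(x, y)"] by (auto simp: nbrs_def)
  have "nbrs G x \<subseteq> pverts G"
    by (auto simp: nbrs_def in_arcsD2)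
  hence fin: "finite (nbrs G x)"
    by (rule finite_subset) (rule pair_finite_verts)
  define g where "g = (\<lambda>z. if z = y then 1 else 0 :: real)"
  have "Gam G g g x > 0"
    unfolding Gam_eq using fin y \<open>y \<noteq> x\<close>
    by (auto simp: g_def intro!: sum_pos2[of _ y])
  hence "bdd_above S"
    by (intro bdd_aboveI[of _ "q g / Gam G g g x"]) (auto simp: S pos_le_divide_eq)
  hence up: "K \<in> S \<Longrightarrow> K \<le> Sup S" for K by (rule cSup_upper[rotated])
  have Sup: "Sup S \<in> S" unfolding S
  proof
    fix f
    show "Sup S * Gam G f f x \<le> q f"
    proof (cases "Gam G f f x = 0")
      case True
      thus ?thesis using K0 by (auto simp: S dest: spec[of _ f])
    next
      case False
      hence "Gam G f f x > 0" using Gam_nonneg[of G f x] by simp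
      moreover from this have "Sup S \<le> q f / Gam G f f x"
        using K0 by (intro cSup_least) (blast, simp add: S pos_le_divide_eq)
      ultimately show ?thesis by (simp add: pos_le_divide_eq)
    qed
  qed
  have "BE_curvature G x N = Sup S"
    unfolding BE_curvature_def using Sup up by (intro Greatest_equality) (auto simp: S_def)
  with Sup up show "curvature_dim G x N (BE_curvature G x N)"
    and "curvature_dim G x N K \<Longrightarrow> K \<le> BE_curvature G x N"
    by (auto simp: S_def)
qed

end

theory Submission
  imports Defs
begin

text \<open>
  In a triangle-free strongly regular graph, let \<open>f\<close> vanish at \<open>x\<close>. A vertex \<open>z\<close> at distance 2 from
  \<open>x\<close> has \<open>\<beta>\<close> neighbours in common with \<open>x\<close>, so the part of \<open>\<Gamma>\<^sub>2(f)(x)\<close> involving \<open>f z\<close> is quadratic in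
  \<open>f z\<close>, minimal when \<open>f z\<close> is twice the mean of \<open>f\<close> over these neighbours. After this minimization,
  \<open>2\<Gamma>\<^sub>2(f)(x)\<close> depends only on \<open>U = \<Sum> (f y)\<^sup>2\<close> and \<open>S = (\<Sum> f y)\<^sup>2\<close>, both sums over the neighbours of \<open>x\<close>,
  and equals \<open>(2 + d - 2d/\<beta>) U - (1 - 2/\<beta>) S\<close>. Since \<open>S/U\<close> takes values in \<open>[0, d]\<close> and the curvature
  inequality is linear in it, only the two endpoints matter. Girth 4 forces \<open>\<beta> \<ge> 2\<close> and girth 5
  forces \<open>\<beta> = 1\<close>.
\<close>

section \<open>Neighbourhoods, girth and short cycles\<close>

context pair_graph
begin

lemma nbrs_iff: "y \<in> nbrs G x \<longleftrightarrow> (x, y) \<in> parcs G"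
  by (simp add: nbrs_def)

lemma nbrs_sym: "y \<in> nbrs G x \<Longrightarrow> x \<in> nbrs G y"
  using pair_sym_arcs by (auto simp: nbrs_iff symmetric_def sym_def)

lemma nbrs_irrefl: "x \<notin> nbrs G x"
  using pair_no_loops[of "(x, x)"] by (auto simp: nbrs_iff)

lemma nbrs_in_verts: "y \<in> nbrs G x \<Longrightarrow> y \<in> pverts G"
  by (simp add: nbrs_iff in_arcsD2)

lemma finite_nbrs: "finite (nbrs G x)"
  using pair_finite_verts by (rule finite_subset[rotated]) (auto intro: nbrs_in_verts)

lemma girth_attained:
  assumes "girth G = enat k"
  obtains p where "cycle p" "length p = k" "k \<ge> 3"
proof -
  define A where "A = (\<lambda>p. enat (length p)) ` {p. cycle p \<and> length p \<ge> 3}"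
  have g: "girth G = Inf A" by (simp add: girth_def A_def)
  \<comment> \<open>The infimum of the empty set is infinity, so a finite girth yields a cycle; a
    nonempty set in \<open>enat\<close> contains its infimum.\<close>
  with assms have "A \<noteq> {}" by (auto simp: Inf_enat_def)
  hence "Inf A \<in> A" using wellorder_InfI by blast
  hence "enat k \<in> A" using g assms by simp
  thus thesis using that by (auto simp: A_def)
qed

lemma girth_le:
  assumes "cycle p" "length p \<ge> 3"
  shows "girth G \<le> enat (length p)"
  unfolding girth_def using assms by (intro INF_lower) auto

lemma girth_triangle:
  assumes "y \<in> nbrs G x" "z \<in> nbrs G y" "x \<in> nbrs G z"
  shows "girth G \<le> 3"
proof -
  have "x \<noteq> y" "y \<noteq> z" "z \<noteq> x" using assms nbrs_irrefl by blast+
  hence "cycle [(x, y), (y, z), (z, x)]"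
    using assms by (auto simp: cycle_def awalk_def nbrs_iff in_arcsD1)
  from girth_le[OF this] show ?thesis by (simp add: numeral_eq_enat eval_nat_numeral)
qed

lemma girth_square:
  assumes "y \<in> nbrs G x" "z \<in> nbrs G y" "w \<in> nbrs G z" "x \<in> nbrs G w" "x \<noteq> z" "y \<noteq> w"
  shows "girth G \<le> 4"
proof -
  have "x \<noteq> y" "y \<noteq> z" "z \<noteq> w" "w \<noteq> x" using assms nbrs_irrefl by blast+
  hence "cycle [(x, y), (y, z), (z, w), (w, x)]"
    using assms by (auto simp: cycle_def awalk_def nbrs_iff in_arcsD1)
  from girth_le[OF this] show ?thesis by (simp add: numeral_eq_enat eval_nat_numeral)
qed

text \<open>Supplies a vertex with two distinct neighbours, hence \<open>d \<ge> 2\<close>, and for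
  girth 5 the path whose endpoints determine \<open>\<beta>\<close>.\<close>

lemma cycle_path3:
  assumes "cycle p" "length p \<ge> 3"
  obtains x y z where "x \<in> pverts G" "y \<in> nbrs G x" "z \<in> nbrs G y" "x \<noteq> z"
proof -
  obtain u where u: "pcas u p u" "set p \<subseteq> parcs G" "distinct (tl (pawalk_verts u p))"
    using assms(1) by (auto simp: cycle_def awalk_def)
  obtain a b c q where p: "p = a # b # c # q"
    using assms(2) by (auto simp: numeral_eq_Suc Suc_le_length_iff)
  obtain v w t where abc: "a = (u, v)" "b = (v, w)" "c = (w, t)"
    using u(1) by (cases a; cases b; cases c) (auto simp: p)
  have "pcas t q u" using u(1) by (simp add: p abc)
  \<comment> \<open>The walk closes at \<open>u\<close>, so \<open>u\<close> recurs after
    \<open>w\<close> in the tail of the vertex list, whose entries are distinct. The third arc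
    matters: a closed walk of two arcs has \<open>w = u\<close>.\<close>
  hence last: "u \<in> set (pawalk_verts t q)"
    by (induction q arbitrary: t) auto
  have "w \<noteq> u" using u(3) last by (auto simp: p abc)
  thus thesis using that[of u v w] u(2) by (auto simp: p abc nbrs_iff in_arcsD1)
qed

lemma cycle4_square:
  assumes "cycle p" "length p = 4"
  obtains x y z w where "y \<in> nbrs G x" "z \<in> nbrs G y" "w \<in> nbrs G z" "x \<in> nbrs G w"
    "x \<noteq> z" "y \<noteq> w"
proof -
  obtain u where u: "pcas u p u" "set p \<subseteq> parcs G" "distinct (tl (pawalk_verts u p))"
    using assms(1) by (auto simp: cycle_def awalk_def)
  obtain a b c e where p: "p = [a, b, c, e]"
    using assms(2) by (auto simp: numeral_eq_Suc length_Suc_conv)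
  show thesis
    \<comment> \<open>The vertices are the tails of the four arcs in cyclic order;
      \<open>fst b\<close> comes first because \<open>y\<close> occurs before \<open>x\<close> in
      the first premise of \<open>that\<close>.\<close>
    using u that[of "fst b" "fst a" "fst c" "fst e"]
    by (cases a; cases b; cases c; cases e) (auto simp: p nbrs_iff)
qed

end

section \<open>Counting paths of length 2 in triangle-free strongly regular graphs\<close>

locale triangle_free_srg = pair_graph G for G :: "'a pair_pre_digraph" +
  fixes d \<beta> :: nat
  assumes degree: "x \<in> pverts G \<Longrightarrow> card (nbrs G x) = d"
    and triangle_free: "y \<in> nbrs G x \<Longrightarrow> nbrs G x \<inter> nbrs G y = {}"
    and common: "\<lbrakk>x \<in> pverts G; y \<in> pverts G; x \<noteq> y; y \<notin> nbrs G x\<rbrakk>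
      \<Longrightarrow> card (nbrs G x \<inter> nbrs G y) = \<beta>"
    and beta_pos: "\<beta> > 0"
begin

text \<open>Since \<open>\<beta> > 0\<close>, every vertex outside the unit ball has distance 2 from its centre.\<close>

definition sphere2 :: "'a \<Rightarrow> 'a set" where
  "sphere2 x = pverts G - insert x (nbrs G x)"

lemma finite_sphere2: "finite (sphere2 x)"
  by (simp add: sphere2_def pair_finite_verts)

text \<open>Without triangles, a walk of length 2 from \<open>x\<close> returns to \<open>x\<close>
  or ends in \<open>sphere2 x\<close>. Grouping by the endpoint \<open>z\<close>, the possible
  midpoints are the common neighbours of \<open>x\<close> and \<open>z\<close>. This splits the
  double sum in \<open>Gam2_eq\<close>.\<close>

lemma sum_paths2:
  fixes h :: "'a \<Rightarrow> 'a \<Rightarrow> real"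
  shows "(\<Sum>y\<in>nbrs G x. \<Sum>z\<in>nbrs G y. h y z)
    = (\<Sum>y\<in>nbrs G x. h y x) + (\<Sum>z\<in>sphere2 x. \<Sum>y\<in>nbrs G x \<inter> nbrs G z. h y z)"
proof -
  have "(\<Sum>z\<in>nbrs G y. h y z) = h y x + (\<Sum>z\<in>{z \<in> sphere2 x. y \<in> nbrs G z}. h y z)"
    if y: "y \<in> nbrs G x" for y
  proof -
    have "nbrs G y - {x} = {z \<in> sphere2 x. y \<in> nbrs G z}"
      using triangle_free[OF y] nbrs_in_verts nbrs_sym by (auto simp: sphere2_def)
    thus ?thesis using sum.remove[OF finite_nbrs nbrs_sym[OF y], of "h y"] by simp
  qed
  hence "(\<Sum>y\<in>nbrs G x. \<Sum>z\<in>nbrs G y. h y z)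
      = (\<Sum>y\<in>nbrs G x. h y x) + (\<Sum>y\<in>nbrs G x. \<Sum>z\<in>{z \<in> sphere2 x. y \<in> nbrs G z}. h y z)"
    by (simp add: sum.distrib)
  also have "(\<Sum>y\<in>nbrs G x. \<Sum>z\<in>{z \<in> sphere2 x. y \<in> nbrs G z}. h y z)
      = (\<Sum>z\<in>sphere2 x. \<Sum>y\<in>{y \<in> nbrs G x. y \<in> nbrs G z}. h y z)"
    by (rule sum.swap_restrict) (rule finite_nbrs finite_sphere2)+
  also have "\<dots> = (\<Sum>z\<in>sphere2 x. \<Sum>y\<in>nbrs G x \<inter> nbrs G z. h y z)"
    by (simp add: Int_def)
  finally show ?thesis .
qed

text \<open>An edge between two neighbours of \<open>x\<close> would close a triangle, so distinct
  ones are non-adjacent.\<close>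

lemma card_common_nbrs:
  assumes "y \<in> nbrs G x" "y' \<in> nbrs G x"
  shows "card (nbrs G y \<inter> nbrs G y') = (if y = y' then d else \<beta>)"
proof -
  have "y' \<notin> nbrs G y" using triangle_free[OF assms(1)] assms(2) by blast
  thus ?thesis using assms nbrs_in_verts degree common by auto
qed

text \<open>The sum of \<open>u y * T z\<close> over walks \<open>x, y, z\<close> is computed twice:
  for fixed \<open>y\<close> by counting common neighbours of pairs \<open>y\<close>,
  \<open>y'\<close>, and by endpoints \<open>z\<close>, where the squares of \<open>T z\<close>
  appear.\<close>

lemma sum_sphere2_power2:
  fixes u :: "'a \<Rightarrow> real"
  assumes "x \<in> pverts G"
  shows "(\<Sum>z\<in>sphere2 x. (\<Sum>y\<in>nbrs G x \<inter> nbrs G z. u y)\<^sup>2)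
    = (real d - real \<beta>) * (\<Sum>y\<in>nbrs G x. (u y)\<^sup>2) + (real \<beta> - 1) * (\<Sum>y\<in>nbrs G x. u y)\<^sup>2"
proof -
  define A where "A = nbrs G x"
  define T where "T z = (\<Sum>y\<in>A \<inter> nbrs G z. u y)" for z
  have finA: "finite A" by (simp add: A_def finite_nbrs)
  \<comment> \<open>Here \<open>z\<close> may also be \<open>x\<close>, so the full counts
    \<open>d\<close> and \<open>\<beta>\<close> apply; the contribution of \<open>z = x\<close>,
    with \<open>T x = sum u A\<close>, is split off afterwards.\<close>
  have inner: "(\<Sum>z\<in>nbrs G y. T z) = (real d - real \<beta>) * u y + real \<beta> * sum u A" if y: "y \<in> A" for y
  proof -
    have "(\<Sum>z\<in>nbrs G y. T z) = (\<Sum>z\<in>nbrs G y. \<Sum>y'\<in>{y' \<in> A. y' \<in> nbrs G z}. u y')"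
      by (simp add: T_def Int_def)
    also have "\<dots> = (\<Sum>y'\<in>A. \<Sum>z\<in>{z \<in> nbrs G y. y' \<in> nbrs G z}. u y')"
      using finite_nbrs finA by (intro sum.swap_restrict)
    also have "\<dots> = (\<Sum>y'\<in>A. real (if y = y' then d else \<beta>) * u y')"
    proof (rule sum.cong)
      fix y' assume y': "y' \<in> A"
      have "{z \<in> nbrs G y. y' \<in> nbrs G z} = nbrs G y \<inter> nbrs G y'"
        using nbrs_sym by blast
      thus "(\<Sum>z\<in>{z \<in> nbrs G y. y' \<in> nbrs G z}. u y') = real (if y = y' then d else \<beta>) * u y'"
        using card_common_nbrs[of y x y'] y y' by (simp add: A_def)
    qed simp
    also have "\<dots> = (\<Sum>y'\<in>A. (if y = y' then (real d - real \<beta>) * u y' else 0) + real \<beta> * u y')"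
      by (intro sum.cong) (auto simp: algebra_simps)
    also have "\<dots> = (real d - real \<beta>) * u y + real \<beta> * sum u A"
      using y finA by (simp add: sum.distrib sum.delta' sum_distrib_left)
    finally show ?thesis .
  qed
  have "(\<Sum>y\<in>A. \<Sum>z\<in>nbrs G y. u y * T z)
      = (\<Sum>y\<in>A. u y * T x) + (\<Sum>z\<in>sphere2 x. \<Sum>y\<in>A \<inter> nbrs G z. u y * T z)"
    unfolding A_def by (rule sum_paths2)
  also have "(\<Sum>y\<in>A. u y * T x) = (sum u A)\<^sup>2"
    by (simp add: T_def A_def power2_eq_square flip: sum_distrib_right)
  also have "(\<Sum>z\<in>sphere2 x. \<Sum>y\<in>A \<inter> nbrs G z. u y * T z) = (\<Sum>z\<in>sphere2 x. (T z)\<^sup>2)"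
    by (simp add: T_def power2_eq_square flip: sum_distrib_right)
  also have "(\<Sum>y\<in>A. \<Sum>z\<in>nbrs G y. u y * T z)
      = (\<Sum>y\<in>A. (real d - real \<beta>) * (u y)\<^sup>2 + real \<beta> * sum u A * u y)"
    by (intro sum.cong refl, simp only: inner flip: sum_distrib_left)
      (simp add: power2_eq_square algebra_simps)
  also have "\<dots> = (real d - real \<beta>) * (\<Sum>y\<in>A. (u y)\<^sup>2) + real \<beta> * (sum u A)\<^sup>2"
    by (simp add: sum.distrib power2_eq_square flip: sum_distrib_left)
  finally show ?thesis by (simp add: T_def A_def algebra_simps)
qed

section \<open>The curvature inequality and its optimal constant\<close>

lemma Gam2_formula:
  fixes f :: "'a \<Rightarrow> real"
  assumes x: "x \<in> pverts G"
  shows "2 * Gam2 G f f x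
    = (2 + real d - 2 * real d / \<beta>) * (\<Sum>y\<in>nbrs G x. (f y - f x)\<^sup>2)
      - (1 - 2 / \<beta>) * (\<Sum>y\<in>nbrs G x. f y - f x)\<^sup>2
      + \<beta> / 2 * (\<Sum>z\<in>sphere2 x.
          (f z - f x - 2 / \<beta> * (\<Sum>y\<in>nbrs G x \<inter> nbrs G z. f y - f x))\<^sup>2)"
proof -
  define u where "u y = f y - f x" for y
  define A where "A = nbrs G x"
  define U where "U = (\<Sum>y\<in>A. (u y)\<^sup>2)"
  define T where "T z = (\<Sum>y\<in>A \<inter> nbrs G z. u y)" for z
  define W where "W = (\<Sum>z\<in>sphere2 x. (u z - 2 / \<beta> * T z)\<^sup>2)"
  define Q where "Q z = (\<Sum>y\<in>A \<inter> nbrs G z. (u y)\<^sup>2)" for z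
  have b: "real \<beta> > 0" using beta_pos by simp
  have cardA: "card A = d" using x by (simp add: A_def degree)
  \<comment> \<open>Each neighbour of \<open>x\<close> has \<open>d\<close> neighbours:
    \<open>x\<close> itself and \<open>d - 1\<close> vertices of \<open>sphere2 x\<close>.\<close>
  have Q: "(\<Sum>z\<in>sphere2 x. Q z) = (real d - 1) * U"
  proof -
    have "real d * U = (\<Sum>y\<in>A. \<Sum>z\<in>nbrs G y. (u y)\<^sup>2)"
      unfolding U_def sum_distrib_left using nbrs_in_verts
      by (intro sum.cong) (auto simp: A_def degree)
    also have "\<dots> = U + (\<Sum>z\<in>sphere2 x. Q z)"
      unfolding A_def U_def Q_def by (rule sum_paths2)
    finally show ?thesis by (simp add: algebra_simps)
  qed
  have T: "(\<Sum>z\<in>sphere2 x. (T z)\<^sup>2) = (real d - real \<beta>) * U + (real \<beta> - 1) * (sum u A)\<^sup>2"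
    unfolding T_def U_def A_def by (rule sum_sphere2_power2[OF x])
  have inner: "(\<Sum>y\<in>A \<inter> nbrs G z. (f z - f y)\<^sup>2 / 2 - (f y - f x) * (f z - f y))
      = \<beta> / 2 * (u z - 2 / \<beta> * T z)\<^sup>2 - 2 / \<beta> * (T z)\<^sup>2 + 3 / 2 * Q z"
    if z: "z \<in> sphere2 x" for z
  proof -
    have "card (A \<inter> nbrs G z) = \<beta>"
      using z x by (auto simp: sphere2_def A_def common)
    moreover have "(f z - f y)\<^sup>2 / 2 - (f y - f x) * (f z - f y)
        = (u z)\<^sup>2 / 2 - 2 * u z * u y + 3 / 2 * (u y)\<^sup>2" for y
      by (simp add: u_def power2_eq_square field_simps)
    ultimately have "(\<Sum>y\<in>A \<inter> nbrs G z. (f z - f y)\<^sup>2 / 2 - (f y - f x) * (f z - f y))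
        = \<beta> * ((u z)\<^sup>2 / 2) - 2 * u z * T z + 3 / 2 * Q z"
      by (simp add: T_def Q_def sum.distrib sum_subtractf flip: sum_distrib_left sum_divide_distrib)
    \<comment> \<open>Completing the square in \<open>u z\<close>; the remaining squares of
      \<open>T z\<close> are summed by \<open>sum_sphere2_power2\<close>.\<close>
    also have "\<beta> * ((u z)\<^sup>2 / 2) - 2 * u z * T z
        = \<beta> / 2 * (u z - 2 / \<beta> * T z)\<^sup>2 - 2 / \<beta> * (T z)\<^sup>2"
      using b by (simp add: power2_eq_square field_simps)
    finally show ?thesis .
  qed
  have "2 * Gam2 G f f x
      = (\<Sum>y\<in>A. (f x - f y)\<^sup>2 / 2 - (f y - f x) * (f x - f y))
        + (\<Sum>z\<in>sphere2 x. \<beta> / 2 * (u z - 2 / \<beta> * T z)\<^sup>2 - 2 / \<beta> * (T z)\<^sup>2 + 3 / 2 * Q z)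
        - d * (U / 2) + (sum u A)\<^sup>2"
    using inner cardA
    by (simp add: Gam2_eq sum_paths2 Gam_eq laplacian_def U_def u_def A_def power2_eq_square)
  also have "(\<Sum>y\<in>A. (f x - f y)\<^sup>2 / 2 - (f y - f x) * (f x - f y)) = 3 / 2 * U"
    unfolding U_def sum_distrib_left
    by (intro sum.cong) (auto simp: u_def power2_eq_square field_simps)
  also have "(\<Sum>z\<in>sphere2 x. \<beta> / 2 * (u z - 2 / \<beta> * T z)\<^sup>2 - 2 / \<beta> * (T z)\<^sup>2 + 3 / 2 * Q z)
      = \<beta> / 2 * (\<Sum>z\<in>sphere2 x. (u z - 2 / \<beta> * T z)\<^sup>2)
        - 2 / \<beta> * (\<Sum>z\<in>sphere2 x. (T z)\<^sup>2) + 3 / 2 * (\<Sum>z\<in>sphere2 x. Q z)"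
    by (simp only: sum.distrib sum_subtractf sum_distrib_left)
  also have "3 / 2 * U + (\<beta> / 2 * (\<Sum>z\<in>sphere2 x. (u z - 2 / \<beta> * T z)\<^sup>2)
        - 2 / \<beta> * (\<Sum>z\<in>sphere2 x. (T z)\<^sup>2) + 3 / 2 * (\<Sum>z\<in>sphere2 x. Q z))
        - d * (U / 2) + (sum u A)\<^sup>2
      = (2 + real d - 2 * real d / \<beta>) * U - (1 - 2 / \<beta>) * (sum u A)\<^sup>2
        + \<beta> / 2 * W"
    unfolding Q T W_def[symmetric] using b by (simp add: field_simps)
  finally show ?thesis by (simp add: U_def W_def T_def u_def A_def)
qed

text \<open>The sum over \<open>sphere2 x\<close> in \<open>Gam2_formula\<close> is nonnegative, and
  it vanishes when \<open>u\<close> is extended by twice its mean over the common neighbours. So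
  only the differences at neighbours of \<open>x\<close> matter. The inequality is doubled to absorb
  the factor 1/2 in \<open>Gam\<close>.\<close>

lemma curvature_dim_iff:
  assumes x: "x \<in> pverts G"
  shows "curvature_dim G x N K \<longleftrightarrow>
    (\<forall>u. 2 * real_of_ereal (1 / N) * (\<Sum>y\<in>nbrs G x. u y)\<^sup>2 + K * (\<Sum>y\<in>nbrs G x. (u y)\<^sup>2)
      \<le> (2 + real d - 2 * real d / \<beta>) * (\<Sum>y\<in>nbrs G x. (u y)\<^sup>2)
        - (1 - 2 / \<beta>) * (\<Sum>y\<in>nbrs G x. u y)\<^sup>2)"
    (is "_ \<longleftrightarrow> (\<forall>u. ?L u \<le> ?R u)")
proof -
  have Gam: "2 * (real_of_ereal (1 / N) * (laplacian G f x)\<^sup>2 + K * Gam G f f x)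
      = ?L (\<lambda>y. f y - f x)" for f
    by (simp add: laplacian_def Gam_eq power2_eq_square algebra_simps)
  show ?thesis
  proof safe
    fix u :: "'a \<Rightarrow> real"
    assume *: "curvature_dim G x N K"
    define f where "f z = (if z = x then 0 else if z \<in> nbrs G x then u z
      else 2 / \<beta> * (\<Sum>y\<in>nbrs G x \<inter> nbrs G z. u y))" for z
    have u: "f y - f x = u y" if "y \<in> nbrs G x" for y
      using that nbrs_irrefl by (auto simp: f_def)
    have "?L (\<lambda>y. f y - f x) \<le> 2 * Gam2 G f f x"
      unfolding Gam[symmetric] using * by (intro mult_left_mono) (auto simp: curvature_dim_def)
    also have "\<dots> = ?R (\<lambda>y. f y - f x)"
      unfolding Gam2_formula[OF x] by (simp add: u) (auto simp: sphere2_def f_def)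
    finally show "?L u \<le> ?R u" by (simp add: u)
  next
    assume *: "\<forall>u. ?L u \<le> ?R u"
    show "curvature_dim G x N K" unfolding curvature_dim_def
    proof
      fix f
      have "?L (\<lambda>y. f y - f x) \<le> ?R (\<lambda>y. f y - f x)" using * by blast
      also have "\<dots> \<le> 2 * Gam2 G f f x"
        unfolding Gam2_formula[OF x] by (simp add: sum_nonneg)
      finally show "real_of_ereal (1 / N) * (laplacian G f x)\<^sup>2 + K * Gam G f f x \<le> Gam2 G f f x"
        unfolding Gam[symmetric] by simp
    qed
  qed
qed

text \<open>
  The two terms of the minimum are attained at functions that are constant, respectively of mean
  zero, on the neighbours of \<open>x\<close>; the latter are nontrivial only for \<open>d \<ge> 2\<close>.
\<close>

lemma BE_curvature_formula:
  assumes x: "x \<in> pverts G" and d: "d \<ge> 2"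
  shows "BE_curvature G x N
    = min (2 - 2 * real d * real_of_ereal (1 / N)) (2 + real d - 2 * real d / \<beta>)"
    (is "_ = min ?p ?q")
  unfolding BE_curvature_def
proof (rule Greatest_equality)
  define A where "A = nbrs G x"
  define a where "a = real_of_ereal (1 / N)"
  have finA: "finite A" and cardA: "card A = d"
    using x by (simp_all add: A_def finite_nbrs degree)
  have b: "real \<beta> > 0" using beta_pos by simp
  note iff = curvature_dim_iff[OF x, of N, folded A_def a_def]
  show "curvature_dim G x N (min ?p ?q)" unfolding iff
  proof
    fix u :: "'a \<Rightarrow> real"
    define U S m where "U = (\<Sum>y\<in>A. (u y)\<^sup>2)" and "S = (\<Sum>y\<in>A. u y)\<^sup>2" and "m = min ?p ?q"
    have "S \<le> d * U"
      using Cauchy_Schwarz_ineq_sum[of "\<lambda>_. 1" u A] cardA by (simp add: S_def U_def)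
    \<comment> \<open>Interpolation between the endpoints: up to the factor \<open>d\<close>, the
      slack is linear in \<open>S\<close>, equal to \<open>(?q - m) * U\<close> at
      \<open>S = 0\<close> and \<open>(?p - m) * U\<close> at \<open>S = d * U\<close>.\<close>
    hence "0 \<le> (?q - m) * (d * U - S) + (?p - m) * S"
      by (intro add_nonneg_nonneg mult_nonneg_nonneg) (auto simp: m_def S_def)
    also have "\<dots> = d * (?q * U - (1 - 2 / \<beta>) * S - (2 * a * S + m * U))"
      using b by (simp add: a_def field_simps)
    finally have "2 * a * S + m * U \<le> ?q * U - (1 - 2 / \<beta>) * S"
      using d by (simp add: zero_le_mult_iff)
    thus "2 * a * (\<Sum>y\<in>A. u y)\<^sup>2 + min ?p ?q * (\<Sum>y\<in>A. (u y)\<^sup>2)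
        \<le> ?q * (\<Sum>y\<in>A. (u y)\<^sup>2) - (1 - 2 / \<beta>) * (\<Sum>y\<in>A. u y)\<^sup>2"
      by (simp add: U_def S_def m_def)
  qed
  fix K assume "curvature_dim G x N K"
  hence K: "2 * a * (\<Sum>y\<in>A. u y)\<^sup>2 + K * (\<Sum>y\<in>A. (u y)\<^sup>2)
        \<le> ?q * (\<Sum>y\<in>A. (u y)\<^sup>2) - (1 - 2 / \<beta>) * (\<Sum>y\<in>A. u y)\<^sup>2" for u
    unfolding iff by blast
  have "d * (2 * a * d + K) \<le> d * (?q - (1 - 2 / \<beta>) * d)"
    using K[of "\<lambda>_. 1"] by (simp add: cardA power2_eq_square algebra_simps)
  hence "2 * a * d + K \<le> ?q - (1 - 2 / \<beta>) * d" using d by simp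
  also have "\<dots> = 2" using b by (simp add: field_simps)
  finally have 1: "K \<le> ?p" by (simp add: a_def mult_ac)
  obtain B where B: "B \<subseteq> A" "card B = 2" "finite B"
    using d cardA obtain_subset_with_card_n by metis
  then obtain y z where yz: "B = {y, z}" "y \<noteq> z" by (auto simp: card_2_iff)
  define v :: "'a \<Rightarrow> real" where "v t = (if t = y then 1 else if t = z then - 1 else 0)" for t
  have "(\<Sum>t\<in>A. v t) = (\<Sum>t\<in>B. v t)" and "(\<Sum>t\<in>A. (v t)\<^sup>2) = (\<Sum>t\<in>B. (v t)\<^sup>2)"
    using B finA by (intro sum.mono_neutral_right; auto simp: v_def yz)+
  hence "(\<Sum>t\<in>A. v t) = 0" and "(\<Sum>t\<in>A. (v t)\<^sup>2) = 2"
    using yz by (simp_all add: v_def)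
  hence 2: "K \<le> ?q" using K[of v] by simp
  from 1 2 show "K \<le> min ?p ?q" by simp
qed

end

section \<open>The cases of girth 4 and girth 5\<close>

lemma triangle_free_srgI:
  assumes "strongly_regular G n d \<alpha> \<beta>" "\<beta> \<ge> 1" "girth G > 3"
  shows "triangle_free_srg G d \<beta>"
proof -
  interpret pair_graph G using assms(1) by (simp add: strongly_regular_def)
  show ?thesis
  proof unfold_locales
    show "nbrs G x \<inter> nbrs G y = {}" if "y \<in> nbrs G x" for x y
      using girth_triangle[OF that] nbrs_sym assms(3) by (fastforce simp: not_less[symmetric])
  qed (use assms in \<open>auto simp: strongly_regular_def nbrs_iff\<close>)
qed

theorem corollary11p7:
  fixes G :: "'a pair_pre_digraph" and n d \<alpha> \<beta> :: nat
  assumes "strongly_regular G n d \<alpha> \<beta>" and "\<beta> \<ge> 1"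
  shows "(girth G = 4 \<longrightarrow>
      (\<forall>x\<in>pverts G. \<forall>N::ereal. 0 < N \<longrightarrow>
        BE_curvature G x N = 2 - real_of_ereal (ereal (2 * real d) / N))) \<and>
    (girth G = 5 \<longrightarrow>
      (\<forall>x\<in>pverts G. \<forall>N::ereal. 0 < N \<longrightarrow>
        BE_curvature G x N =
          (if N \<le> 2 then 2 - real_of_ereal (ereal (2 * real d) / N) else 2 - real d)))"
proof -
  interpret pair_graph G using assms(1) by (simp add: strongly_regular_def)
  have div: "real_of_ereal (ereal (2 * real d) / N) = 2 * real d * real_of_ereal (1 / N)"
    if "0 < N" for N
    using that by (cases N) (auto simp: one_ereal_def)
  \<comment> \<open>Opposite vertices \<open>x\<close> and \<open>z\<close> of a 4-cycle are
    non-adjacent, since triangles are excluded, and share the neighbours \<open>y\<close> and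
    \<open>w\<close>.\<close>
  have common2: "\<beta> \<ge> 2"
    if "girth G > 3" "x \<in> pverts G" "y \<in> nbrs G x" "z \<in> nbrs G y" "w \<in> nbrs G z" "x \<in> nbrs G w"
      "x \<noteq> z" "y \<noteq> w" for x y z w
  proof -
    interpret triangle_free_srg G d \<beta> using assms that(1) by (rule triangle_free_srgI)
    have "z \<notin> nbrs G x" using triangle_free[OF that(3)] that(4) by blast
    hence "card (nbrs G x \<inter> nbrs G z) = \<beta>"
      using that nbrs_in_verts by (intro common) auto
    moreover have "{y, w} \<subseteq> nbrs G x \<inter> nbrs G z" using that nbrs_sym by blast
    hence "card {y, w} \<le> card (nbrs G x \<inter> nbrs G z)"
      by (intro card_mono) (auto simp: finite_nbrs)
    ultimately show ?thesis using that(8) by simp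
  qed
  \<comment> \<open>The middle vertex of two consecutive edges of a cycle has two neighbours, and
    the graph is regular.\<close>
  have degree2: "d \<ge> 2" if k: "girth G = enat k" for k
  proof -
    obtain p where "cycle p" "length p \<ge> 3" using girth_attained[OF k] by metis
    then obtain x y z where xyz: "x \<in> pverts G" "y \<in> nbrs G x" "z \<in> nbrs G y" "x \<noteq> z"
      by (rule cycle_path3)
    hence "card {x, z} \<le> card (nbrs G y)"
      using nbrs_sym by (intro card_mono finite_nbrs) auto
    moreover have "card (nbrs G y) = d"
      using assms(1) nbrs_in_verts xyz by (auto simp: strongly_regular_def)
    ultimately show ?thesis using xyz by simp
  qed
  show ?thesis
  proof (intro conjI impI ballI allI)
    fix x and N :: ereal
    assume g: "girth G = 4" and x: "x \<in> pverts G" and N: "0 < N"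
    have g3: "girth G > 3" by (simp add: g)
    interpret triangle_free_srg G d \<beta> using assms g3 by (rule triangle_free_srgI)
    obtain p where "cycle p" "length p = 4"
      using g girth_attained[of 4] by (auto simp: numeral_eq_enat)
    then obtain a b c e where "b \<in> nbrs G a" "c \<in> nbrs G b" "e \<in> nbrs G c" "a \<in> nbrs G e"
      "a \<noteq> c" "b \<noteq> e"
      by (rule cycle4_square)
    hence "\<beta> \<ge> 2" using common2[OF g3, of a b c e] nbrs_in_verts by blast
    \<comment> \<open>With \<open>\<beta> \<ge> 2\<close> the second term of the minimum is at least
      2, while the first is at most 2.\<close>
    hence "2 * real d / \<beta> \<le> d"
      using mult_left_mono[of 2 "real \<beta>" "real d"] by (simp add: field_simps)
    moreover have "real_of_ereal (1 / N) \<ge> 0"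
      using N by (cases N) (auto simp: one_ereal_def)
    hence "2 * real d * real_of_ereal (1 / N) \<ge> 0" by simp
    ultimately have "2 - 2 * real d * real_of_ereal (1 / N) \<le> 2 + real d - 2 * real d / \<beta>"
      by linarith
    thus "BE_curvature G x N = 2 - real_of_ereal (ereal (2 * real d) / N)"
      using BE_curvature_formula[OF x degree2, of 4 N] g N by (simp add: div numeral_eq_enat)
  next
    fix x and N :: ereal
    assume g: "girth G = 5" and x: "x \<in> pverts G" and N: "0 < N"
    have g3: "girth G > 3" by (simp add: g)
    interpret triangle_free_srg G d \<beta> using assms g3 by (rule triangle_free_srgI)
    obtain p where "cycle p" "length p \<ge> 3"
      using g girth_attained[of 5] by (metis numeral_eq_enat)
    then obtain a b c where abc: "a \<in> pverts G" "b \<in> nbrs G a" "c \<in> nbrs G b" "a \<noteq> c"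
      by (rule cycle_path3)
    \<comment> \<open>A second common neighbour of \<open>a\<close> and \<open>c\<close> would
      create a 4-cycle, so \<open>\<beta>\<close> is at most 1.\<close>
    have "nbrs G a \<inter> nbrs G c \<subseteq> {b}"
    proof
      fix w assume w: "w \<in> nbrs G a \<inter> nbrs G c"
      show "w \<in> {b}"
      proof (rule ccontr)
        assume "w \<notin> {b}"
        hence "girth G \<le> 4" using abc w nbrs_sym by (intro girth_square[of b a c w]) auto
        thus False by (simp add: g)
      qed
    qed
    hence "card (nbrs G a \<inter> nbrs G c) \<le> 1" using card_mono[of "{b}"] by fastforce
    moreover have "c \<notin> nbrs G a" using triangle_free[OF abc(2)] abc(3) by blast
    hence "card (nbrs G a \<inter> nbrs G c) = \<beta>"
      using abc nbrs_in_verts by (intro common) auto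
    ultimately have b: "\<beta> = 1" using assms(2) by simp
    have d: "d \<ge> 2" using degree2[of 5] g by (simp add: numeral_eq_enat)
    \<comment> \<open>For \<open>\<beta> = 1\<close> the second term is \<open>2 - d\<close>, and
      dividing by \<open>d > 0\<close> puts the crossover at \<open>N = 2\<close>; for infinite
      \<open>N\<close> the reciprocal is 0.\<close>
    have "2 - 2 * real d * real_of_ereal (1 / N) \<le> 2 - real d \<longleftrightarrow> N \<le> 2"
      using N d by (cases N) (auto simp: one_ereal_def field_simps)
    thus "BE_curvature G x N =
        (if N \<le> 2 then 2 - real_of_ereal (ereal (2 * real d) / N) else 2 - real d)"
      using BE_curvature_formula[OF x d, of N] N by (auto simp: div b min_def)
  qed
qed

end
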